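(* There are infinitely many pairwise non-isomorphic graphs $G$ in which half of the vertices are good, i.e. $|K(G)|=\tfrac12|V(G)|$.
   Context: All graphs are finite, simple, undirected and connected. For vertices $a,b$ of a connected graph $G$, the resistance distance $\Omega_G(a,b)$ is the effective resistance between $a$ and $b$ in the electrical network obtained from $G$ by replacing each edge by a unit resistor; equivalently $\Omega_G(a,b)=(e_a-e_b)^{T}L^{\dagger}(e_a-e_b)$, where $L$ is the Laplacian matrix of $G$, $L^{\dagger}$ its Moore–Penrose inverse, and $e_a$ the standard unit vector indexed by $a$. The Kirchhoff index of a connected graph $G$ is $Kf(G)=\sum_{\{u,v\}\subseteq V(G)}\Omega_G(u,v)$, the sum over unordered pairs of distinct vertices. $G-v$ denotes the graph obtained from $G$ by deleting the vertex $v$ and its incident edges. A vertex $v$ of $G$ is good if $G-v$ is connected and $Kf(G)=Kf(G-v)$ (cut vertices are not good). $K(G)$ denotes the set of good vertices of $G$. *)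

theory Defs
  imports Complex_Main "Graph_Theory.Graph_Theory"
begin

text \<open>
  Finite simple undirected graphs are the symmetric loop-free finite digraphs of the locales
  \<^locale>\<open>graph\<close> and \<^locale>\<open>pair_graph\<close>, an edge being a pair of opposite arcs.

  Real matrices indexed by a finite set \<open>V\<close> are functions that vanish outside \<open>V \<times> V\<close>, so
  that equality of matrices is equality of functions.
\<close>

definition matrices_on :: "'a set \<Rightarrow> ('a \<Rightarrow> 'a \<Rightarrow> real) set" where
  "matrices_on V = {A. \<forall>u v. u \<notin> V \<or> v \<notin> V \<longrightarrow> A u v = 0}"

definition matrix_prod ::
    "'a set \<Rightarrow> ('a \<Rightarrow> 'a \<Rightarrow> real) \<Rightarrow> ('a \<Rightarrow> 'a \<Rightarrow> real) \<Rightarrow> 'a \<Rightarrow> 'a \<Rightarrow> real" where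
  "matrix_prod V A B = (\<lambda>u v. \<Sum>w\<in>V. A u w * B w v)"

definition symmetric_matrix :: "('a \<Rightarrow> 'a \<Rightarrow> real) \<Rightarrow> bool" where
  "symmetric_matrix A \<longleftrightarrow> (\<forall>u v. A u v = A v u)"

text \<open>The four Penrose equations; they determine \<open>X\<close> uniquely.\<close>

definition is_moore_penrose_inverse ::
    "'a set \<Rightarrow> ('a \<Rightarrow> 'a \<Rightarrow> real) \<Rightarrow> ('a \<Rightarrow> 'a \<Rightarrow> real) \<Rightarrow> bool" where
  "is_moore_penrose_inverse V A X \<longleftrightarrow>
     X \<in> matrices_on V \<and>
     matrix_prod V (matrix_prod V A X) A = A \<and>
     matrix_prod V (matrix_prod V X A) X = X \<and>
     symmetric_matrix (matrix_prod V A X) \<and>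
     symmetric_matrix (matrix_prod V X A)"

definition moore_penrose_inverse :: "'a set \<Rightarrow> ('a \<Rightarrow> 'a \<Rightarrow> real) \<Rightarrow> 'a \<Rightarrow> 'a \<Rightarrow> real" where
  "moore_penrose_inverse V A = (THE X. is_moore_penrose_inverse V A X)"

lemma matrix_prod_assoc:
  "matrix_prod V (matrix_prod V A B) C = matrix_prod V A (matrix_prod V B C)"
proof (intro ext)
  fix u v
  have "matrix_prod V (matrix_prod V A B) C u v = (\<Sum>w\<in>V. \<Sum>x\<in>V. A u x * B x w * C w v)"
    by (simp add: matrix_prod_def sum_distrib_right)
  also have "\<dots> = (\<Sum>x\<in>V. \<Sum>w\<in>V. A u x * B x w * C w v)"
    by (rule sum.swap)
  also have "\<dots> = matrix_prod V A (matrix_prod V B C) u v"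
    by (simp add: matrix_prod_def sum_distrib_left mult.assoc)
  finally show "matrix_prod V (matrix_prod V A B) C u v = matrix_prod V A (matrix_prod V B C) u v" .
qed

lemma symmetric_matrix_prod_commute:
  assumes "symmetric_matrix P" "symmetric_matrix Q" "symmetric_matrix (matrix_prod V P Q)"
  shows "matrix_prod V P Q = matrix_prod V Q P"
proof (intro ext)
  fix u v
  have "matrix_prod V P Q u v = matrix_prod V P Q v u"
    using assms(3) by (simp add: symmetric_matrix_def)
  also have "\<dots> = (\<Sum>w\<in>V. P w v * Q u w)"
    using assms(1,2) unfolding matrix_prod_def symmetric_matrix_def
    by (intro sum.cong) auto
  also have "\<dots> = matrix_prod V Q P u v"
    by (simp add: matrix_prod_def mult.commute)
  finally show "matrix_prod V P Q u v = matrix_prod V Q P u v" .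
qed

lemma moore_penrose_inverse_unique:
  assumes X: "is_moore_penrose_inverse V A X" and Y: "is_moore_penrose_inverse V A Y"
  shows "X = Y"
proof -
  note d = is_moore_penrose_inverse_def
  let ?m = "matrix_prod V"
  have X': "?m (?m A X) A = A" "?m (?m X A) X = X"
      "symmetric_matrix (?m A X)" "symmetric_matrix (?m X A)"
    using X by (auto simp: d)
  have Y': "?m (?m A Y) A = A" "?m (?m Y A) Y = Y"
      "symmetric_matrix (?m A Y)" "symmetric_matrix (?m Y A)"
    using Y by (auto simp: d)
  have l1: "?m (?m A Y) (?m A X) = ?m A X" by (metis Y'(1) matrix_prod_assoc)
  have l2: "?m (?m A X) (?m A Y) = ?m A Y" by (metis X'(1) matrix_prod_assoc)
  have AX: "?m A X = ?m A Y"
    using symmetric_matrix_prod_commute[OF Y'(3) X'(3)] l1 l2 X'(3) by simp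
  have r1: "?m (?m X A) (?m Y A) = ?m X A" by (metis Y'(1) matrix_prod_assoc)
  have r2: "?m (?m Y A) (?m X A) = ?m Y A" by (metis X'(1) matrix_prod_assoc)
  have XA: "?m X A = ?m Y A"
    using symmetric_matrix_prod_commute[OF X'(4) Y'(4)] r1 r2 X'(4) by simp
  show ?thesis by (metis AX XA X'(2) Y'(2) matrix_prod_assoc)
qed

lemma moore_penrose_inverse_eqI:
  "is_moore_penrose_inverse V A X \<Longrightarrow> moore_penrose_inverse V A = X"
  unfolding moore_penrose_inverse_def
  by (rule the_equality) (auto intro: moore_penrose_inverse_unique)

definition laplacian :: "('a, 'b) pre_digraph \<Rightarrow> 'a \<Rightarrow> 'a \<Rightarrow> real" where
  "laplacian G = (\<lambda>u v.
     if u \<in> verts G \<and> v \<in> verts G then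
       (if u = v then real (out_degree G u) else if (u, v) \<in> arcs_ends G then - 1 else 0)
     else 0)"

definition unit_vector :: "'a \<Rightarrow> 'a \<Rightarrow> real" where
  "unit_vector a = (\<lambda>u. if u = a then 1 else 0)"

definition resistance_distance :: "('a, 'b) pre_digraph \<Rightarrow> 'a \<Rightarrow> 'a \<Rightarrow> real" where
  "resistance_distance G a b =
     (\<Sum>u\<in>verts G. \<Sum>v\<in>verts G.
        (unit_vector a u - unit_vector b u) *
        moore_penrose_inverse (verts G) (laplacian G) u v *
        (unit_vector a v - unit_vector b v))"

lemma resistance_distance_sym: "resistance_distance G a b = resistance_distance G b a"
  unfolding resistance_distance_def
  by (intro sum.cong refl) (simp add: algebra_simps)

text \<open>Every unordered pair of distinct vertices corresponds to two ordered ones, whence the factor.\<close>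

definition kirchhoff_index :: "('a, 'b) pre_digraph \<Rightarrow> real" where
  "kirchhoff_index G =
     (\<Sum>(u, v) \<in> {(u, v) \<in> verts G \<times> verts G. u \<noteq> v}. resistance_distance G u v) / 2"

definition good_vertices :: "('a, 'b) pre_digraph \<Rightarrow> 'a set" where
  "good_vertices G =
     {v \<in> verts G. Digraph_Component.connected (pre_digraph.del_vert G v) \<and>
        kirchhoff_index G = kirchhoff_index (pre_digraph.del_vert G v)}"

end

theory Submission
  imports Defs
begin

text \<open>
  Glue copies of the diamond (\<open>K\<^sub>4\<close> minus an edge), rooted at a vertex of degree two, together with
  triangles and pendant edges, all at one common root. In such a bouquet on \<open>n\<close> vertices let \<open>Q\<close> be
  the sum of all resistance distances to the root. Resistances add up across the root, so
  \<open>Kf = n Q + \<Sum>\<^sub>i \<psi>\<^sub>i\<close> with a term \<open>\<psi>\<^sub>i\<close> that depends only on the \<open>i\<close>-th petal. Deleting a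
  neighbour of the root from a diamond turns that petal into a path, raises its contribution to
  \<open>Q\<close> from \<open>9 / 4\<close> to \<open>3\<close> and leaves \<open>\<psi>\<^sub>i = - 5\<close> unchanged; hence that vertex is good if and
  only if \<open>Q = 3 / 4 * (n - 1)\<close>. Every other deletion of a non-root vertex lowers the Kirchhoff
  index, and the root is a cut vertex. With \<open>8 t + 1\<close> diamonds, \<open>3 t\<close> triangles and \<open>2 t\<close> pendant
  edges one has \<open>n = 32 t + 4\<close> and \<open>Q = 24 t + 9 / 4\<close>, so the \<open>16 t + 2\<close> neighbours of the root in
  the diamonds are exactly the good vertices.
\<close>

section \<open>Resistance distances from a solution of the Poisson equation\<close>

text \<open>Double centring turns \<open>M\<close> into the Moore-Penrose inverse of
  \<open>A\<close>: with \<open>P = I - J / n\<close>, \<open>J\<close> the all-ones matrix,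
  \<open>X = P M P\<close> satisfies \<open>A X = X A = P\<close>, and \<open>P\<close> fixes
  \<open>A\<close> and \<open>X\<close>. The quadratic form at \<open>e_a - e_b\<close> does not see
  the centring terms.\<close>

lemma moore_penrose_quadratic_form:
  fixes M :: "'a \<Rightarrow> 'a \<Rightarrow> real"
  assumes fin: "finite V"
    and A: "A \<in> matrices_on V" "symmetric_matrix A" "\<And>u. u \<in> V \<Longrightarrow> (\<Sum>v\<in>V. A u v) = 0"
    and M: "symmetric_matrix M"
    and AM: "\<And>u w. u \<in> V \<Longrightarrow> w \<in> V \<Longrightarrow> (\<Sum>v\<in>V. A u v * M v w) = (if u = w then 1 else 0) - c u"
    and ab: "a \<in> V" "b \<in> V"
  shows "(\<Sum>u\<in>V. \<Sum>v\<in>V. (unit_vector a u - unit_vector b u) * moore_penrose_inverse V A u v *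
           (unit_vector a v - unit_vector b v)) = M a a + M b b - 2 * M a b"
proof -
  define n where "n = real (card V)"
  have n: "n > 0" using fin ab by (auto simp: n_def card_gt_0_iff)
  \<comment> \<open>\<open>r\<close> holds the row means of \<open>M\<close> and \<open>m\<close> is
    their mean, so that the rows of \<open>X\<close> sum to zero.\<close>
  define r where "r u = (\<Sum>w\<in>V. M u w) / n" for u
  define m where "m = (\<Sum>w\<in>V. r w) / n"
  define X where "X u v = (if u \<in> V \<and> v \<in> V then M u v - r u - r v + m else 0)" for u v
  define P where "P u v = (if u \<in> V \<and> v \<in> V then (if u = v then 1 else 0) - 1 / n else 0)" for u v :: 'a
  have Msym: "M u v = M v u" for u v using M by (simp add: symmetric_matrix_def)
  have Asym: "A u v = A v u" for u v using A by (simp add: symmetric_matrix_def)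
  have Xsym: "X u v = X v u" for u v by (simp add: X_def Msym)
  have A0: "A u v = 0" if "u \<notin> V \<or> v \<notin> V" for u v using A that by (auto simp: matrices_on_def)
  have X0: "X u v = 0" if "u \<notin> V \<or> v \<notin> V" for u v using that by (auto simp: X_def)
  have Xrow: "(\<Sum>v\<in>V. X u v) = 0" if "u \<in> V" for u
  proof -
    have "(\<Sum>v\<in>V. X u v) = (\<Sum>v\<in>V. M u v) - n * r u - (\<Sum>v\<in>V. r v) + n * m"
      using that by (simp add: X_def sum.distrib sum_subtractf n_def)
    also have "\<dots> = 0" using n by (simp add: r_def m_def)
    finally show ?thesis .
  qed
  \<comment> \<open>This is the average of \<open>AM\<close> over the column index
    \<open>w\<close>.\<close>
  have Ar: "(\<Sum>v\<in>V. A u v * r v) = 1 / n - c u" if "u \<in> V" for u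
  proof -
    have "(\<Sum>v\<in>V. A u v * r v) = (\<Sum>v\<in>V. \<Sum>w\<in>V. A u v * M v w) / n"
      by (simp add: r_def sum_divide_distrib sum_distrib_left)
    also have "(\<Sum>v\<in>V. \<Sum>w\<in>V. A u v * M v w) = (\<Sum>w\<in>V. \<Sum>v\<in>V. A u v * M v w)"
      by (rule sum.swap)
    also have "\<dots> = (\<Sum>w\<in>V. (if u = w then 1 else 0) - c u)"
      using that by (intro sum.cong) (auto simp: AM)
    also have "\<dots> = 1 - n * c u" using that fin by (simp add: sum_subtractf n_def)
    finally show ?thesis using n by (simp add: field_simps)
  qed
  have AX: "matrix_prod V A X = P"
  proof (intro ext)
    fix u w
    show "matrix_prod V A X u w = P u w"
    proof (cases "u \<in> V \<and> w \<in> V")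
      case True
      have "matrix_prod V A X u w =
          (\<Sum>v\<in>V. A u v * M v w - A u v * r v + A u v * (m - r w))"
        using True unfolding matrix_prod_def X_def by (intro sum.cong) (auto simp: algebra_simps)
      also have "\<dots> = (\<Sum>v\<in>V. A u v * M v w) - (\<Sum>v\<in>V. A u v * r v) + (\<Sum>v\<in>V. A u v) * (m - r w)"
        by (simp add: sum.distrib sum_subtractf sum_distrib_right)
      also have "\<dots> = P u w" using True by (simp add: AM Ar A(3) P_def)
      finally show ?thesis .
    next
      case False
      then show ?thesis by (auto simp: matrix_prod_def P_def A0 X0)
    qed
  qed
  have Psym: "P u v = P v u" for u v by (simp add: P_def)
  have XA: "matrix_prod V X A = P"
  proof (intro ext)
    fix u v
    have "matrix_prod V X A u v = matrix_prod V A X v u"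
      unfolding matrix_prod_def by (intro sum.cong refl) (metis Asym Xsym mult.commute)
    then show "matrix_prod V X A u v = P u v" by (simp add: AX Psym)
  qed
  \<comment> \<open>Symmetry of \<open>B\<close> trades the column sums that arise in
    \<open>P B\<close> for row sums, which vanish.\<close>
  have Pl: "matrix_prod V P B = B"
    if B: "\<And>u v. B u v = B v u" "\<And>u. u \<in> V \<Longrightarrow> (\<Sum>v\<in>V. B u v) = 0"
      "\<And>u v. u \<notin> V \<or> v \<notin> V \<Longrightarrow> B u v = 0" for B :: "'a \<Rightarrow> 'a \<Rightarrow> real"
  proof (intro ext)
    fix u v
    show "matrix_prod V P B u v = B u v"
    proof (cases "u \<in> V \<and> v \<in> V")
      case True
      have "matrix_prod V P B u v = (\<Sum>w\<in>V. (if u = w then B w v else 0) - 1 / n * B v w)"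
        unfolding matrix_prod_def using True B(1)
        by (intro sum.cong) (auto simp: P_def algebra_simps)
      also have "\<dots> = (\<Sum>w\<in>V. if u = w then B w v else 0) - 1 / n * (\<Sum>w\<in>V. B v w)"
        by (simp only: sum_subtractf sum_distrib_left)
      also have "\<dots> = B u v" using True B(2) fin by simp
      finally show ?thesis .
    next
      case False
      then show ?thesis by (auto simp: matrix_prod_def P_def B(3))
    qed
  qed
  have "is_moore_penrose_inverse V A X"
    unfolding is_moore_penrose_inverse_def
    using Pl[of A] Pl[of X] Asym Xsym A(3) Xrow A0 X0
    by (simp add: AX XA symmetric_matrix_def Psym matrices_on_def)
  then have mp: "moore_penrose_inverse V A = X" by (rule moore_penrose_inverse_eqI)
  have ev: "(\<Sum>v\<in>V. (unit_vector a v - unit_vector b v) * f v) = f a - f b" for f :: "'a \<Rightarrow> real"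
  proof -
    have "(\<Sum>v\<in>V. (unit_vector a v - unit_vector b v) * f v) =
        (\<Sum>v\<in>V. (if v = a then f v else 0) - (if v = b then f v else 0))"
      by (intro sum.cong) (auto simp: unit_vector_def algebra_simps)
    then show ?thesis using fin ab by (simp add: sum_subtractf)
  qed
  have "(\<Sum>u\<in>V. \<Sum>v\<in>V. (unit_vector a u - unit_vector b u) * X u v * (unit_vector a v - unit_vector b v))
      = (\<Sum>u\<in>V. (unit_vector a u - unit_vector b u) *
          (\<Sum>v\<in>V. (unit_vector a v - unit_vector b v) * X u v))"
    by (simp add: sum_distrib_left mult_ac)
  also have "\<dots> = X a a - X a b - (X b a - X b b)" by (simp add: ev)
  also have "\<dots> = M a a + M b b - 2 * M a b" using ab by (simp add: X_def Msym[of b a])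
  finally show ?thesis by (simp add: mp)
qed

section \<open>Laplacians and resistance distances of pair graphs\<close>

lemma (in pair_graph) laplacian_symmetric: "laplacian (with_proj G) u v = laplacian (with_proj G) v u"
  using sym_arcs by (auto simp: laplacian_def symmetric_def sym_def)

text \<open>The degree on the diagonal is distributed over the neighbours, so that Poisson equations
  can be checked through differences along edges.\<close>

lemma (in pair_graph) laplacian_apply:
  assumes "u \<in> pverts G"
  shows "(\<Sum>v\<in>pverts G. laplacian (with_proj G) u v * f v) =
    (\<Sum>v\<in>pverts G. if (u, v) \<in> parcs G then f u - f v else 0)"
proof -
  let ?N = "{v \<in> pverts G. (u, v) \<in> parcs G}"
  have out: "out_arcs (with_proj G) u = Pair u ` ?N"
    by (auto simp: out_arcs_def in_arcsD2)
  have deg: "real (out_degree (with_proj G) u) = (\<Sum>v\<in>pverts G. if (u, v) \<in> parcs G then 1 else 0)"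
    by (simp add: out_degree_def out card_image inj_on_def sum.If_cases Int_def)
  have loop: "(u, u) \<notin> parcs G" using no_loops by fastforce
  have "(\<Sum>v\<in>pverts G. laplacian (with_proj G) u v * f v) =
     (\<Sum>v\<in>pverts G. (if v = u then real (out_degree (with_proj G) u) * f u else 0) -
        (if (u, v) \<in> parcs G then f v else 0))"
    using assms loop by (intro sum.cong) (auto simp: laplacian_def)
  also have "\<dots> = real (out_degree (with_proj G) u) * f u -
     (\<Sum>v\<in>pverts G. if (u, v) \<in> parcs G then f v else 0)"
    using assms by (simp add: sum_subtractf)
  also have "\<dots> = (\<Sum>v\<in>pverts G. if (u, v) \<in> parcs G then f u - f v else 0)"
    unfolding deg sum_distrib_right sum_subtractf[symmetric] by (intro sum.cong) auto
  finally show ?thesis .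
qed

text \<open>Taking \<open>M = - R / 2\<close> in the previous lemmas: a symmetric \<open>R\<close> with zero diagonal is the
  resistance matrix as soon as \<open>L R + 2 I\<close> has constant rows.\<close>

lemma (in pair_graph) resistance_distance_eqI:
  assumes R: "\<And>u v. R u v = R v u" "\<And>u. R u u = 0"
    and LR: "\<And>u w. u \<in> pverts G \<Longrightarrow> w \<in> pverts G \<Longrightarrow>
      (\<Sum>v\<in>pverts G. if (u, v) \<in> parcs G then R u w - R v w else 0) = c u - (if u = w then 2 else 0)"
    and "a \<in> pverts G" "b \<in> pverts G"
  shows "resistance_distance (with_proj G) a b = R a b"
proof -
  let ?L = "laplacian (with_proj G)"
  have "resistance_distance (with_proj G) a b =
      (- R a a / 2) + (- R b b / 2) - 2 * (- R a b / 2)"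
    unfolding resistance_distance_def with_proj_simps
  proof (rule moore_penrose_quadratic_form[where M = "\<lambda>u v. - R u v / 2" and c = "\<lambda>u. c u / 2"])
    show "?L \<in> matrices_on (pverts G)" by (auto simp: matrices_on_def laplacian_def)
    show "symmetric_matrix ?L" by (simp add: symmetric_matrix_def laplacian_symmetric)
    show "(\<Sum>v\<in>pverts G. ?L u v) = 0" if "u \<in> pverts G" for u
      using laplacian_apply[OF that, of "\<lambda>_. 1"] by (simp cong: if_cong)
    show "symmetric_matrix (\<lambda>u v. - R u v / 2)" using R(1) by (simp add: symmetric_matrix_def)
    fix u w assume uw: "u \<in> pverts G" "w \<in> pverts G"
    have "(\<Sum>v\<in>pverts G. ?L u v * (- R v w / 2)) = - (\<Sum>v\<in>pverts G. ?L u v * R v w) / 2"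
      by (simp add: sum_negf sum_divide_distrib)
    also have "\<dots> = - (c u - (if u = w then 2 else 0)) / 2"
      using laplacian_apply[OF uw(1), of "\<lambda>v. R v w"] LR[OF uw] by simp
    also have "\<dots> = (if u = w then 1 else 0) - c u / 2" by simp
    finally show "(\<Sum>v\<in>pverts G. ?L u v * (- R v w / 2)) = (if u = w then 1 else 0) - c u / 2" .
  qed (use assms in auto)
  then show ?thesis by (simp add: R)
qed

lemma kirchhoff_index_eq_sum:
  assumes "finite (verts G)"
    and R: "\<And>u. R u u = 0"
    and "\<And>u v. u \<in> verts G \<Longrightarrow> v \<in> verts G \<Longrightarrow> resistance_distance G u v = R u v"
  shows "kirchhoff_index G = (\<Sum>u\<in>verts G. \<Sum>v\<in>verts G. R u v) / 2"
proof -
  have "(\<Sum>(u, v) \<in> {(u, v) \<in> verts G \<times> verts G. u \<noteq> v}. resistance_distance G u v) =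
      (\<Sum>(u, v) \<in> {(u, v) \<in> verts G \<times> verts G. u \<noteq> v}. R u v)"
    using assms by (intro sum.cong) auto
  also have "\<dots> = (\<Sum>(u, v) \<in> verts G \<times> verts G. R u v)"
    using assms(1) R by (intro sum.mono_neutral_left) auto
  also have "\<dots> = (\<Sum>u\<in>verts G. \<Sum>v\<in>verts G. R u v)"
    by (simp add: sum.cartesian_product)
  finally show ?thesis by (simp add: kirchhoff_index_def)
qed

section \<open>Bouquets of induced subgraphs of the diamond\<close>

text \<open>The diamond is \<open>K\<^sub>4\<close> on \<open>{0, 1, 2, 3}\<close> without the edge \<open>{0, 3}\<close>. A petal
  is given by the set \<open>T \<subseteq> {1, 2, 3}\<close> of vertices that it retains besides the root \<open>0\<close>. The
  cases of \<open>petal_resistance\<close> are the diamond, the paths \<open>0 - 1 - 3\<close> and \<open>0 - 2 - 3\<close>, the triangle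
  and the single edge.\<close>

definition diamond_adj :: "nat \<Rightarrow> nat \<Rightarrow> bool" where
  "diamond_adj x y \<longleftrightarrow> x \<noteq> y \<and> {x, y} \<noteq> {0, 3}"

text \<open>Of the subsets of \<open>{1, 2, 3}\<close> only \<open>{3}\<close> is missing: it would
  leave vertex \<open>3\<close> disconnected from the root.\<close>

definition petals :: "nat set set" where
  "petals = {{}, {1}, {2}, {1, 2}, {1, 3}, {2, 3}, {1, 2, 3}}"

definition petal_resistance :: "nat set \<Rightarrow> nat \<Rightarrow> nat \<Rightarrow> real" where
  "petal_resistance T x y =
    (if x = y then 0
     else if T = {1, 2, 3} then (if {x, y} = {0, 3} then 1 else if {x, y} = {1, 2} then 1 / 2 else 5 / 8)
     else if 3 \<in> T then (if {x, y} = {0, 3} then 2 else 1)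
     else if T = {1, 2} then 2 / 3 else 1)"

text \<open>Vertex \<open>x > 0\<close> of the \<open>i\<close>-th petal is encoded as \<open>3 i + x\<close>; the common root is \<open>0\<close>.\<close>

definition petal_of :: "nat \<Rightarrow> nat" where
  "petal_of u = (u - 1) div 3"

text \<open>Truncated subtraction puts the root formally into petal \<open>0\<close>; therefore the
  definitions below test for the root separately.\<close>

definition slot :: "nat \<Rightarrow> nat" where
  "slot u = (if u = 0 then 0 else Suc ((u - 1) mod 3))"

definition bouquet :: "nat \<Rightarrow> (nat \<Rightarrow> nat set) \<Rightarrow> nat pair_pre_digraph" where
  "bouquet m S =
    (let V = insert 0 (\<Union>i<m. (\<lambda>x. 3 * i + x) ` S i) in
     \<lparr>pverts = V,
      parcs = {(u, v) \<in> V \<times> V. (u = 0 \<or> v = 0 \<or> petal_of u = petal_of v) \<and> diamond_adj (slot u) (slot v)}\<rparr>)"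

text \<open>The root separates distinct petals, so resistances across it add in series.\<close>

definition bouquet_resistance :: "(nat \<Rightarrow> nat set) \<Rightarrow> nat \<Rightarrow> nat \<Rightarrow> real" where
  "bouquet_resistance S u v =
    (if u = 0 then petal_resistance (S (petal_of v)) 0 (slot v)
     else if v = 0 \<or> petal_of u = petal_of v then petal_resistance (S (petal_of u)) (slot u) (slot v)
     else petal_resistance (S (petal_of u)) (slot u) 0 + petal_resistance (S (petal_of v)) 0 (slot v))"

lemma pverts_bouquet: "pverts (bouquet m S) = insert 0 (\<Union>i<m. (\<lambda>x. 3 * i + x) ` S i)"
  by (simp add: bouquet_def Let_def)

lemma parcs_bouquet_iff: "(u, v) \<in> parcs (bouquet m S) \<longleftrightarrow>
    u \<in> pverts (bouquet m S) \<and> v \<in> pverts (bouquet m S) \<and>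
    (u = 0 \<or> v = 0 \<or> petal_of u = petal_of v) \<and> diamond_adj (slot u) (slot v)"
  by (simp add: bouquet_def Let_def)

lemma petals_cases:
  assumes "T \<in> petals"
  obtains "T = {}" | "T = {1}" | "T = {2}" | "T = {1, 2}" | "T = {1, 3}" | "T = {2, 3}" | "T = {1, 2, 3}"
  using assms by (auto simp: petals_def)

lemma petal_neqs:
  "{1, 2} \<noteq> {1, 2, 3 :: nat}" "{1, 3} \<noteq> {1, 2, 3 :: nat}" "{2, 3} \<noteq> {1, 2, 3 :: nat}"
  "{1} \<noteq> {1, 2, 3 :: nat}" "{2} \<noteq> {1, 2, 3 :: nat}" "{1} \<noteq> {1, 2 :: nat}" "{2} \<noteq> {1, 2 :: nat}"
proof -
  have "(1 :: nat) \<notin> {2, 3}" by simp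
  then show "{2, 3} \<noteq> {1, 2, 3 :: nat}" by blast
qed auto

lemma petals_subset: "T \<in> petals \<Longrightarrow> T \<subseteq> {1, 2, 3}"
  by (erule petals_cases) auto

lemma diamond_adj_sym: "diamond_adj x y = diamond_adj y x"
  by (auto simp: diamond_adj_def doubleton_eq_iff)

lemma petal_resistance_sym: "petal_resistance T x y = petal_resistance T y x"
  by (simp add: petal_resistance_def insert_commute)

lemma petal_resistance_same [simp]: "petal_resistance T x x = 0"
  by (simp add: petal_resistance_def)

text \<open>The row constant of \<open>L R + 2 I\<close> in row \<open>x\<close>, read off from the entry in column \<open>0\<close>.\<close>

definition petal_const :: "nat set \<Rightarrow> nat \<Rightarrow> real" where
  "petal_const T x = (if x = 0 then 2 else 0) + (\<Sum>y\<in>insert 0 T.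
     if diamond_adj x y then petal_resistance T x 0 - petal_resistance T y 0 else 0)"

text \<open>The criterion of \<open>resistance_distance_eqI\<close> for a single petal, checked
  entry by entry over the seven petals.\<close>

lemma petal_laplacian:
  assumes "T \<in> petals" "x \<in> insert 0 T" "w \<in> insert 0 T"
  shows "(\<Sum>y\<in>insert 0 T. if diamond_adj x y then petal_resistance T x w - petal_resistance T y w else 0)
    = petal_const T x - (if x = w then 2 else 0)"
proof -
  \<comment> \<open>The simplifier turns \<open>1\<close> into \<open>Suc 0\<close>; the set
    inequalities must have that form to select the branch of
    \<open>petal_resistance\<close>.\<close>
  note [simp] = petal_const_def petal_resistance_def diamond_adj_def doubleton_eq_iff
    petal_neqs[unfolded One_nat_def]
  have "\<forall>x\<in>insert 0 T. \<forall>w\<in>insert 0 T.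
      (\<Sum>y\<in>insert 0 T. if diamond_adj x y then petal_resistance T x w - petal_resistance T y w else 0)
      = petal_const T x - (if x = w then 2 else 0)"
    using assms(1) by (rule petals_cases) simp_all
  then show ?thesis using assms(2,3) by blast
qed

lemma petal_of_slot [simp]:
  assumes "x \<in> {1, 2, 3}"
  shows "petal_of (3 * i + x) = i" "slot (3 * i + x) = x" "3 * i + x > 0"
proof -
  have *: "3 * i + x - 1 = 3 * i + (x - 1)" "x - 1 < 3" "x \<noteq> 0" using assms by auto
  show "petal_of (3 * i + x) = i" unfolding petal_of_def *(1) using *(2) by simp
  have "(3 * i + (x - 1)) mod 3 = x - 1" using *(2) by simp
  then show "slot (3 * i + x) = x" unfolding slot_def *(1) using *(3) by simp
  show "3 * i + x > 0" using assms by auto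
qed

lemma slot_0 [simp]: "slot 0 = 0"
  by (simp add: slot_def)

lemma petal_slot_inj:
  fixes x y :: nat
  assumes "x \<in> {1, 2, 3}" "y \<in> {1, 2, 3}" "3 * i + x = 3 * j + y"
  shows "i = j" "x = y"
  using petal_of_slot(1,2)[OF assms(1), of i] petal_of_slot(1,2)[OF assms(2), of j]
  unfolding assms(3) by simp_all

lemma bouquet_resistance_sym: "bouquet_resistance S u v = bouquet_resistance S v u"
  by (auto simp: bouquet_resistance_def petal_resistance_sym)

lemma bouquet_resistance_same [simp]: "bouquet_resistance S u u = 0"
  by (simp add: bouquet_resistance_def)

definition petal_sum :: "nat set \<Rightarrow> real" where
  "petal_sum T = (\<Sum>x\<in>T. petal_resistance T x 0)"

text \<open>If all resistances split at the root, the Kirchhoff index would be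
  \<open>(n - 1) Q\<close>. Inside a petal with \<open>k\<close> non-root vertices and sum
  \<open>q\<close>, the share \<open>(k - 1) q\<close> must be replaced by the true sum
  \<open>W\<close> over pairs. Writing the total as \<open>n Q\<close> plus corrections leaves
  \<open>W - k q\<close>, the \<open>\<psi>\<close> of the petal.\<close>

definition petal_excess :: "nat set \<Rightarrow> real" where
  "petal_excess T = (\<Sum>x\<in>T. \<Sum>y\<in>T. petal_resistance T x y) / 2 - real (card T) * petal_sum T"

section \<open>Vertices, arcs and sums over a bouquet\<close>

locale petal_family =
  fixes m :: nat and S :: "nat \<Rightarrow> nat set"
  assumes S: "i < m \<Longrightarrow> S i \<in> petals"
begin

abbreviation "V \<equiv> pverts (bouquet m S)"

lemma S_subset: "i < m \<Longrightarrow> S i \<subseteq> {1, 2, 3}"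
  using S petals_subset by blast

lemma S_slot: "i < m \<Longrightarrow> x \<in> S i \<Longrightarrow> x \<in> {1, 2, 3}"
  using S_subset by blast

lemma finite_S: "i < m \<Longrightarrow> finite (S i)"
  using S_subset finite_subset by blast

lemma finite_V: "finite V"
  using finite_S by (auto simp: pverts_bouquet)

lemma V_cases:
  assumes "u \<in> V"
  obtains "u = 0" | i x where "i < m" "x \<in> S i" "u = 3 * i + x"
  using assms by (auto simp: pverts_bouquet)

lemma in_V_iff:
  assumes "x \<in> {1, 2, 3}"
  shows "3 * i + x \<in> V \<longleftrightarrow> i < m \<and> x \<in> S i"
proof
  assume "3 * i + x \<in> V"
  then show "i < m \<and> x \<in> S i"
  proof (cases rule: V_cases)
    case 1
    then show ?thesis using petal_of_slot(3)[OF assms, of i] by simp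
  next
    case (2 j y)
    then show ?thesis using petal_slot_inj[OF assms S_slot[OF 2(1,2)] 2(3)] by simp
  qed
qed (auto simp: pverts_bouquet)

sublocale pair_graph "bouquet m S"
proof
  show "finite V" by (rule finite_V)
  have "(v, u) \<in> parcs (bouquet m S)" if "(u, v) \<in> parcs (bouquet m S)" for u v
    using that by (auto simp: parcs_bouquet_iff diamond_adj_sym)
  then show "symmetric (with_proj (bouquet m S))"
    by (auto simp: symmetric_def sym_def)
  then show "finite (parcs (bouquet m S))"
    by (rule_tac finite_subset[of _ "V \<times> V"]) (auto simp: parcs_bouquet_iff finite_V)
qed (auto simp: parcs_bouquet_iff diamond_adj_def)

lemma sum_V: "sum f V = f 0 + (\<Sum>i<m. \<Sum>x\<in>S i. f (3 * i + x))" for f :: "nat \<Rightarrow> 'b :: comm_monoid_add"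
proof -
  let ?P = "\<lambda>i. (\<lambda>x. 3 * i + x) ` S i"
  have "0 \<notin> (\<Union>i<m. ?P i)" using S_slot[of _ 0] by auto
  moreover have "finite (\<Union>i<m. ?P i)" using finite_S by auto
  ultimately have "sum f V = f 0 + sum f (\<Union>i<m. ?P i)"
    unfolding pverts_bouquet by simp
  also have "sum f (\<Union>i<m. ?P i) = (\<Sum>i<m. sum f (?P i))"
  proof (rule sum.UNION_disjoint)
    have "?P i \<inter> ?P j = {}" if "i < m" "j < m" "i \<noteq> j" for i j
    proof (rule ccontr)
      assume "?P i \<inter> ?P j \<noteq> {}"
      then obtain x y where xy: "x \<in> S i" "y \<in> S j" "3 * i + x = 3 * j + y" by auto
      show False using petal_slot_inj(1)[OF S_slot S_slot xy(3)] xy that by simp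
    qed
    then show "\<forall>i\<in>{..<m}. \<forall>j\<in>{..<m}. i \<noteq> j \<longrightarrow> ?P i \<inter> ?P j = {}" by simp
  qed (use finite_S in auto)
  also have "\<dots> = (\<Sum>i<m. \<Sum>x\<in>S i. f (3 * i + x))"
    by (simp add: sum.reindex)
  finally show ?thesis .
qed

lemma card_V: "card V = 1 + (\<Sum>i<m. card (S i))"
  using sum_V[of "\<lambda>_. 1 :: nat"] by simp

lemma sum_petal: "sum f (insert 0 (S i)) = f 0 + (\<Sum>x\<in>S i. f x)" if "i < m"
  for f :: "nat \<Rightarrow> 'b :: comm_monoid_add"
  using that S_slot[of i 0] finite_S by (subst sum.insert) auto

lemma bouquet_resistance_simps:
  "x \<in> {1, 2, 3} \<Longrightarrow> bouquet_resistance S 0 (3 * i + x) = petal_resistance (S i) 0 x"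
  "x \<in> {1, 2, 3} \<Longrightarrow> bouquet_resistance S (3 * i + x) 0 = petal_resistance (S i) x 0"
  "x \<in> {1, 2, 3} \<Longrightarrow> y \<in> {1, 2, 3} \<Longrightarrow> bouquet_resistance S (3 * i + x) (3 * j + y) =
     (if i = j then petal_resistance (S i) x y
      else petal_resistance (S i) x 0 + petal_resistance (S j) 0 y)"
  by (use petal_of_slot in \<open>force simp: bouquet_resistance_def\<close>)+

lemma parcs_bouquet_simps:
  "i < m \<Longrightarrow> x \<in> S i \<Longrightarrow> (0, 3 * i + x) \<in> parcs (bouquet m S) \<longleftrightarrow> diamond_adj 0 x"
  "i < m \<Longrightarrow> x \<in> S i \<Longrightarrow> (3 * i + x, 0) \<in> parcs (bouquet m S) \<longleftrightarrow> diamond_adj x 0"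
  "i < m \<Longrightarrow> x \<in> S i \<Longrightarrow> j < m \<Longrightarrow> y \<in> S j \<Longrightarrow>
     (3 * i + x, 3 * j + y) \<in> parcs (bouquet m S) \<longleftrightarrow> i = j \<and> diamond_adj x y"
  "(0, 0) \<notin> parcs (bouquet m S)"
proof -
  have root: "0 \<in> V" by (simp add: pverts_bouquet)
  have petal: "3 * i + x \<in> V \<and> petal_of (3 * i + x) = i \<and> slot (3 * i + x) = x \<and> 3 * i + x \<noteq> 0"
    if "i < m" "x \<in> S i" for i x
    using that petal_of_slot[OF S_slot[OF that], of i] in_V_iff[OF S_slot[OF that]] by blast
  show "i < m \<Longrightarrow> x \<in> S i \<Longrightarrow> (0, 3 * i + x) \<in> parcs (bouquet m S) \<longleftrightarrow> diamond_adj 0 x"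
    "i < m \<Longrightarrow> x \<in> S i \<Longrightarrow> (3 * i + x, 0) \<in> parcs (bouquet m S) \<longleftrightarrow> diamond_adj x 0"
    using petal[of i x] root by (auto simp only: parcs_bouquet_iff slot_0)
  show "i < m \<Longrightarrow> x \<in> S i \<Longrightarrow> j < m \<Longrightarrow> y \<in> S j \<Longrightarrow>
     (3 * i + x, 3 * j + y) \<in> parcs (bouquet m S) \<longleftrightarrow> i = j \<and> diamond_adj x y"
    using petal[of i x] petal[of j y] by (auto simp only: parcs_bouquet_iff)
  show "(0, 0) \<notin> parcs (bouquet m S)"
    by (simp add: parcs_bouquet_iff diamond_adj_def)
qed

text \<open>A current entering petal \<open>j\<close> from outside sees petal \<open>j\<close> as if it were injected at the root;
  hence the row of the root has constant \<open>2 + \<Sum>\<^sub>i (c\<^sub>i - 2)\<close>, where \<open>c\<^sub>i\<close> is that of the root in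
  petal \<open>i\<close>.\<close>

lemma bouquet_laplacian:
  assumes "u \<in> V" "w \<in> V"
  shows "(\<Sum>v\<in>V. if (u, v) \<in> parcs (bouquet m S)
        then bouquet_resistance S u w - bouquet_resistance S v w else 0) =
     (if u = 0 then 2 + (\<Sum>i<m. petal_const (S i) 0 - 2) else petal_const (S (petal_of u)) (slot u))
       - (if u = w then 2 else 0)"
  (is "?lhs = _")
proof -
  let ?R = "bouquet_resistance S" and ?r = "\<lambda>i. petal_resistance (S i)"
  show ?thesis
    using assms(1)
  proof (cases rule: V_cases)
    case 1
    define h where "h i = (\<Sum>x\<in>S i. if diamond_adj 0 x then ?R 0 w - ?R (3 * i + x) w else 0)" for i
    have L: "?lhs = (\<Sum>i<m. h i)"
      unfolding sum_V h_def 1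
      by (simp add: parcs_bouquet_simps cong: sum.cong_simp)
    have root: "(\<Sum>x\<in>S i. if diamond_adj 0 x then - ?r i x 0 else 0) = petal_const (S i) 0 - 2"
      if "i < m" for i
      using petal_laplacian[OF S[OF that], of 0 0] that
      by (simp add: sum_petal diamond_adj_def cong: if_cong)
    \<comment> \<open>For \<open>w\<close> outside petal \<open>i\<close> its distance to the root
      cancels in each difference, so the petal contributes as in column \<open>0\<close>.\<close>
    have away: "h i = petal_const (S i) 0 - 2" if "i < m" "w = 0 \<or> petal_of w \<noteq> i" for i
    proof -
      have "?R 0 w - ?R (3 * i + x) w = - ?r i x 0" if "x \<in> S i" for x
        using that \<open>i < m\<close> \<open>w = 0 \<or> petal_of w \<noteq> i\<close> S_slot[of i x]
        by (auto simp: bouquet_resistance_def)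
      then have "h i = (\<Sum>x\<in>S i. if diamond_adj 0 x then - ?r i x 0 else 0)"
        unfolding h_def by (intro sum.cong) auto
      then show ?thesis using root that by simp
    qed
    show ?thesis
      using assms(2)
    proof (cases rule: V_cases)
      case 1
      then show ?thesis using L away \<open>u = 0\<close> by simp
    next
      case (2 j y)
      have y: "y \<in> {1, 2, 3}" using 2 S_slot by blast
      have "h j = (\<Sum>x\<in>S j. if diamond_adj 0 x then ?r j 0 y - ?r j x y else 0)"
        unfolding h_def using 2 S_slot y by (intro sum.cong) (auto simp: bouquet_resistance_simps)
      also have "\<dots> = petal_const (S j) 0"
        using petal_laplacian[OF S, of j 0 y] 2 y by (auto simp: sum_petal diamond_adj_def)
      \<comment> \<open>Column \<open>y \<noteq> 0\<close> has no diagonal term in the root's row,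
        so petal \<open>j\<close> contributes \<open>2\<close> more than the pattern of the
        others.\<close>
      finally have hj: "h j = petal_const (S j) 0 - 2 + 2" by simp
      have "(\<Sum>i<m. h i) = (\<Sum>i<m. petal_const (S i) 0 - 2 + (if i = j then 2 else 0))"
        using away hj 2 y by (intro sum.cong) auto
      also have "\<dots> = (\<Sum>i<m. petal_const (S i) 0 - 2) + 2"
        using 2 by (simp only: sum.distrib) simp
      finally show ?thesis using L \<open>u = 0\<close> 2(3) petal_of_slot(3)[OF y, of j] by simp
    qed
  next
    case (2 i x)
    have x: "x \<in> {1, 2, 3}" using 2 S_slot by blast
    \<comment> \<open>Petal \<open>i\<close> sees \<open>w\<close> at \<open>w'\<close>: at its own
      slot if \<open>w\<close> lies in the petal, at the root otherwise.\<close>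
    define w' where "w' = (if w \<noteq> 0 \<and> petal_of w = i then slot w else 0)"
    have w': "w' \<in> insert 0 (S i)"
      using assms(2) by (cases rule: V_cases) (use S_slot in \<open>auto simp: w'_def\<close>)
    have uw: "u = w \<longleftrightarrow> x = w'"
      using assms(2)
    proof (cases rule: V_cases)
      case (2 j y)
      then show ?thesis
        using S_slot[of j y] x \<open>u = 3 * i + x\<close> petal_slot_inj[of x y i j] by (auto simp: w'_def)
    qed (use 2 x in \<open>auto simp: w'_def\<close>)
    have D: "?R u w - ?R v w = ?r i x w' - ?r i y w'"
      if "y \<in> insert 0 (S i)" "v = (if y = 0 then 0 else 3 * i + y)" for y v
    proof -
      \<comment> \<open>For \<open>w\<close> outside petal \<open>i\<close> the second summand does
        not depend on \<open>z\<close> and cancels in \<open>D\<close>.\<close>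
      have val: "?R z w = (if w \<noteq> 0 \<and> petal_of w \<noteq> i then ?r i y 0 + ?r (petal_of w) 0 (slot w) else ?r i y w')"
        if "y \<in> insert 0 (S i)" "z = (if y = 0 then 0 else 3 * i + y)" for y z
      proof (cases "y = 0")
        case False
        then have "y \<in> {1, 2, 3}" using that S_slot[OF 2(1)] by blast
        from petal_of_slot[OF this, of i] have "petal_of z = i" "slot z = y" "z \<noteq> 0"
          using that False by simp_all
        then show ?thesis by (simp add: bouquet_resistance_def w'_def)
      qed (use that in \<open>simp add: bouquet_resistance_def w'_def\<close>)
      have "x \<noteq> 0" using x by auto
      then show ?thesis using val[of x u] val[OF that] 2 by (simp add: w'_def)
    qed
    have D0: "?R u w - ?R 0 w = ?r i x w' - ?r i 0 w'"
      using D[of 0 0] by simp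
    have D1: "?R u w - ?R (3 * i + y) w = ?r i x w' - ?r i y w'" if "y \<in> S i" for y
      using D[of y "3 * i + y"] that S_slot[OF 2(1) that] by auto
    have "(\<Sum>y\<in>S j. if (u, 3 * j + y) \<in> parcs (bouquet m S) then ?R u w - ?R (3 * j + y) w else 0) =
        (if j = i then \<Sum>y\<in>S i. if diamond_adj x y then ?R u w - ?R (3 * i + y) w else 0 else 0)"
      if "j < m" for j
      using that 2 by (auto simp: parcs_bouquet_simps intro!: sum.cong sum.neutral)
    then have "?lhs = (if diamond_adj x 0 then ?R u w - ?R 0 w else 0) +
      (\<Sum>j<m. if j = i then \<Sum>y\<in>S i. if diamond_adj x y then ?R u w - ?R (3 * i + y) w else 0 else 0)"
      unfolding sum_V using 2 by (simp add: parcs_bouquet_simps(2))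
    also have "\<dots> = (if diamond_adj x 0 then ?R u w - ?R 0 w else 0) +
      (\<Sum>y\<in>S i. if diamond_adj x y then ?R u w - ?R (3 * i + y) w else 0)"
      using 2 by simp
    also have "\<dots> = (if diamond_adj x 0 then ?r i x w' - ?r i 0 w' else 0) +
      (\<Sum>y\<in>S i. if diamond_adj x y then ?r i x w' - ?r i y w' else 0)"
      unfolding D0 by (intro arg_cong2[where f = "(+)"] sum.cong) (auto simp: D1)
    also have "\<dots> = petal_const (S i) x - (if x = w' then 2 else 0)"
      using petal_laplacian[OF S, of i x w'] 2 w' by (simp add: sum_petal)
    finally show ?thesis using 2(3) petal_of_slot[OF x, of i] uw by auto
  qed
qed

section \<open>Resistance distances and Kirchhoff index of a bouquet\<close>

lemma resistance_distance_bouquet: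
  "u \<in> V \<Longrightarrow> v \<in> V \<Longrightarrow> resistance_distance (with_proj (bouquet m S)) u v = bouquet_resistance S u v"
  by (rule resistance_distance_eqI[OF bouquet_resistance_sym bouquet_resistance_same bouquet_laplacian])

lemma kirchhoff_index_bouquet:
  "kirchhoff_index (with_proj (bouquet m S)) =
     real (card V) * (\<Sum>i<m. petal_sum (S i)) + (\<Sum>i<m. petal_excess (S i))"
proof -
  let ?R = "bouquet_resistance S" and ?r = "\<lambda>i. petal_resistance (S i)"
  define Q where "Q = (\<Sum>i<m. petal_sum (S i))"
  define N where "N = (\<Sum>i<m. real (card (S i)))"
  have r0: "(\<Sum>x\<in>S i. ?r i 0 x) = petal_sum (S i)" for i
    by (simp add: petal_sum_def petal_resistance_sym[of _ 0])
  have root: "(\<Sum>v\<in>V. ?R 0 v) = Q"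
  proof -
    have "(\<Sum>x\<in>S i. ?R 0 (3 * i + x)) = petal_sum (S i)" if "i < m" for i
      unfolding r0[symmetric] using that by (intro sum.cong refl bouquet_resistance_simps(1)[OF S_slot])
    then show ?thesis by (simp add: sum_V Q_def)
  qed
  \<comment> \<open>All columns are first counted as if the resistance split at the root; the last
    bracket corrects those in petal \<open>i\<close> itself.\<close>
  have row: "(\<Sum>v\<in>V. ?R (3 * i + x) v) = ?r i x 0 + N * ?r i x 0 + Q +
      ((\<Sum>y\<in>S i. ?r i x y) - real (card (S i)) * ?r i x 0 - petal_sum (S i))"
    if ix: "i < m" "x \<in> S i" for i x
  proof -
    note x = S_slot[OF ix]
    have "(\<Sum>y\<in>S j. ?R (3 * i + x) (3 * j + y)) = real (card (S j)) * ?r i x 0 + petal_sum (S j) +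
        (if j = i then (\<Sum>y\<in>S i. ?r i x y) - real (card (S i)) * ?r i x 0 - petal_sum (S i) else 0)"
      if "j < m" for j
    proof -
      have "(\<Sum>y\<in>S j. ?R (3 * i + x) (3 * j + y)) =
          (\<Sum>y\<in>S j. if i = j then ?r i x y else ?r i x 0 + ?r j 0 y)"
        using that by (intro sum.cong refl bouquet_resistance_simps(3)[OF x S_slot])
      then show ?thesis by (auto simp: sum.distrib r0)
    qed
    then have "(\<Sum>v\<in>V. ?R (3 * i + x) v) = ?r i x 0 +
        (\<Sum>j<m. real (card (S j)) * ?r i x 0 + petal_sum (S j) +
        (if j = i then (\<Sum>y\<in>S i. ?r i x y) - real (card (S i)) * ?r i x 0 - petal_sum (S i) else 0))"
      unfolding sum_V by (simp add: bouquet_resistance_simps(2)[OF x])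
    also have "\<dots> = ?r i x 0 + (N * ?r i x 0 + Q +
      ((\<Sum>y\<in>S i. ?r i x y) - real (card (S i)) * ?r i x 0 - petal_sum (S i)))"
      unfolding sum.distrib N_def Q_def sum_distrib_right using ix by simp
    finally show ?thesis by simp
  qed
  have block: "(\<Sum>x\<in>S i. \<Sum>v\<in>V. ?R (3 * i + x) v) =
      (1 + N) * petal_sum (S i) + real (card (S i)) * Q + 2 * petal_excess (S i)" if "i < m" for i
  proof -
    have "(\<Sum>x\<in>S i. \<Sum>v\<in>V. ?R (3 * i + x) v) =
      (\<Sum>x\<in>S i. (1 + N - real (card (S i))) * ?r i x 0 + (Q - petal_sum (S i)) + (\<Sum>y\<in>S i. ?r i x y))"
      using row that by (intro sum.cong) (auto simp: algebra_simps)
    also have "\<dots> = (1 + N - real (card (S i))) * petal_sum (S i) +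
      real (card (S i)) * (Q - petal_sum (S i)) + (\<Sum>x\<in>S i. \<Sum>y\<in>S i. ?r i x y)"
      by (simp add: sum.distrib petal_sum_def sum_distrib_left)
    finally show ?thesis by (simp add: petal_excess_def algebra_simps)
  qed
  have "(\<Sum>u\<in>V. \<Sum>v\<in>V. ?R u v) =
      Q + (\<Sum>i<m. (1 + N) * petal_sum (S i) + real (card (S i)) * Q + 2 * petal_excess (S i))"
    using block by (subst sum_V) (simp add: root)
  also have "\<dots> = Q + ((1 + N) * Q + N * Q + 2 * (\<Sum>i<m. petal_excess (S i)))"
    unfolding sum.distrib sum_distrib_left[symmetric] sum_distrib_right[symmetric] by (simp add: Q_def N_def)
  also have "\<dots> = 2 * ((1 + N) * Q + (\<Sum>i<m. petal_excess (S i)))"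
    by (simp add: algebra_simps)
  finally have "(\<Sum>u\<in>V. \<Sum>v\<in>V. ?R u v) = 2 * ((1 + N) * Q + (\<Sum>i<m. petal_excess (S i)))" .
  moreover have "kirchhoff_index (with_proj (bouquet m S)) = (\<Sum>u\<in>V. \<Sum>v\<in>V. ?R u v) / 2"
    using kirchhoff_index_eq_sum[of "with_proj (bouquet m S)" ?R] finite_V resistance_distance_bouquet
    by simp
  moreover have "1 + N = real (card V)" by (simp add: card_V N_def)
  ultimately show ?thesis by (simp add: Q_def)
qed

end

section \<open>Deletion of vertices\<close>

lemma (in petal_family) petal_nonroot_adj:
  assumes "i < m" "x \<in> S i" "x \<noteq> 3"
  shows "(3 * i + x, 0) \<in> parcs (bouquet m S)"
  using assms S_slot[OF assms(1,2)] by (auto simp: parcs_bouquet_simps diamond_adj_def doubleton_eq_iff)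

text \<open>Connectedness is strong connectedness of the symmetric closure; here the closure changes
  nothing.\<close>

lemma (in pair_graph) mk_symmetric_with_proj: "mk_symmetric (with_proj G) = G"
  using sym_arcs by (auto simp: mk_symmetric_def symmetric_def sym_def intro!: pair_pre_digraph.equality)

text \<open>Every vertex reaches the root in at most two steps, and arcs can be reversed.\<close>

lemma (in petal_family) connected_bouquet: "Digraph_Component.connected (with_proj (bouquet m S))"
proof -
  let ?G = "with_proj (bouquet m S)"
  have to_root: "u \<rightarrow>\<^sup>*\<^bsub>?G\<^esub> 0" if "u \<in> V" for u
    using that
  proof (cases rule: V_cases)
    case 1
    then show ?thesis using that by simp
  next
    case (2 i x)
    show ?thesis
    proof (cases "x = 3")
      case False
      then show ?thesis using petal_nonroot_adj 2 by (intro reachable_adjI) simp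
    next
      case True
      with S[OF 2(1)] 2(2) have "\<exists>y\<in>S i. y \<noteq> 3"
        by (elim petals_cases) auto
      then obtain y where y: "y \<in> S i" "y \<noteq> 3" by blast
      have "(3 * i + x, 3 * i + y) \<in> parcs (bouquet m S)"
        using 2 y True S_slot[OF 2(1) y(1)]
        by (auto simp: parcs_bouquet_simps diamond_adj_def doubleton_eq_iff)
      moreover have "(3 * i + y, 0) \<in> parcs (bouquet m S)"
        using petal_nonroot_adj 2 y by simp
      ultimately show ?thesis
        using 2(3) by (intro adj_reachable_trans[OF _ reachable_adjI]) simp_all
    qed
  qed
  have "strongly_connected ?G"
  proof (rule strongly_connectedI)
    show "verts ?G \<noteq> {}" by (simp add: pverts_bouquet)
    fix u v assume "u \<in> verts ?G" "v \<in> verts ?G"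
    then have "u \<rightarrow>\<^sup>*\<^bsub>?G\<^esub> 0" "v \<rightarrow>\<^sup>*\<^bsub>?G\<^esub> 0" by (simp_all add: to_root)
    then show "u \<rightarrow>\<^sup>*\<^bsub>?G\<^esub> v"
      using symmetric_reachable[OF sym_arcs] reachable_trans by blast
  qed
  then show ?thesis by (simp add: Digraph_Component.connected_def mk_symmetric_with_proj)
qed

text \<open>The remaining vertices keep their codes, and adjacency depends on the codes only; so
  deletion yields a bouquet on the nose, not merely up to isomorphism.\<close>

lemma (in petal_family) del_vert_bouquet:
  assumes "i < m" "x \<in> S i"
  shows "pre_digraph.del_vert (with_proj (bouquet m S)) (3 * i + x) =
    with_proj (bouquet m (S(i := S i - {x})))"
proof -
  have V: "V - {3 * i + x} = pverts (bouquet m (S(i := S i - {x})))"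
  proof (rule set_eqI)
    fix u
    show "u \<in> V - {3 * i + x} \<longleftrightarrow> u \<in> pverts (bouquet m (S(i := S i - {x})))"
    proof
      assume u: "u \<in> V - {3 * i + x}"
      then have "u \<in> V" by simp
      then show "u \<in> pverts (bouquet m (S(i := S i - {x})))"
        by (cases rule: V_cases) (use u in \<open>auto simp: pverts_bouquet\<close>)
    next
      assume "u \<in> pverts (bouquet m (S(i := S i - {x})))"
      then consider "u = 0" | j y where "j < m" "y \<in> S j" "j = i \<Longrightarrow> y \<noteq> x" "u = 3 * j + y"
        by (auto simp: pverts_bouquet split: if_splits)
      then show "u \<in> V - {3 * i + x}"
      proof cases
        case 1
        then show ?thesis using petal_of_slot(3)[OF S_slot[OF assms], of i] by (auto simp: pverts_bouquet)
      next
        case (2 j y)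
        then have "u \<noteq> 3 * i + x"
          using petal_slot_inj[OF S_slot[OF 2(1,2)] S_slot[OF assms], of j i] by metis
        moreover have "u \<in> V" using 2 by (auto simp: pverts_bouquet)
        ultimately show ?thesis by simp
      qed
    qed
  qed
  show ?thesis
  proof (rule pre_digraph.equality)
    show "arcs (pre_digraph.del_vert (with_proj (bouquet m S)) (3 * i + x)) =
      arcs (with_proj (bouquet m (S(i := S i - {x}))))"
      by (auto simp: del_vert_simps parcs_bouquet_iff V[symmetric])
  qed (simp_all add: del_vert_simps V)
qed

text \<open>If the deletion changes \<open>Q\<close> by \<open>d\<close> and the sum of the
  \<open>\<psi>\<close> by \<open>e\<close>, the new index is \<open>(n - 1) (Q + d)\<close> plus
  the new sum; equality with the old index amounts to \<open>Q = (n - 1) d + e\<close>.\<close>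

lemma (in petal_family) kirchhoff_index_del_vert_iff:
  assumes i: "i < m" "x \<in> S i" and T: "S i - {x} \<in> petals"
  shows "kirchhoff_index (with_proj (bouquet m S)) =
      kirchhoff_index (pre_digraph.del_vert (with_proj (bouquet m S)) (3 * i + x)) \<longleftrightarrow>
    (\<Sum>j<m. petal_sum (S j)) = (real (card V) - 1) * (petal_sum (S i - {x}) - petal_sum (S i)) +
      petal_excess (S i - {x}) - petal_excess (S i)"
proof -
  define S' where "S' = S(i := S i - {x})"
  interpret S': petal_family m S'
    by unfold_locales (use S T in \<open>auto simp: S'_def\<close>)
  have change: "(\<Sum>j<m. f (S' j)) = (\<Sum>j<m. f (S j)) + (f (S i - {x}) - f (S i))" for f :: "nat set \<Rightarrow> real"
  proof -
    have "(\<Sum>j<m. f (S' j)) = (\<Sum>j<m. f (S j) + (if j = i then f (S i - {x}) - f (S i) else 0))"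
      by (intro sum.cong) (auto simp: S'_def)
    then show ?thesis using i by (simp add: sum.distrib)
  qed
  have n: "real (card S'.V) = real (card V) - 1"
  proof -
    have "card (S i) > 0" using i finite_S by (auto simp: card_gt_0_iff)
    then have "real (card (S i - {x})) - real (card (S i)) = - 1" using i by (simp add: of_nat_diff)
    then show ?thesis using change[of "\<lambda>T. real (card T)"] by (simp add: card_V S'.card_V)
  qed
  show ?thesis
    unfolding del_vert_bouquet[OF i] S'_def[symmetric] kirchhoff_index_bouquet
      S'.kirchhoff_index_bouquet change n by (auto simp: algebra_simps)
qed

text \<open>Without the root all arcs stay inside a petal, so \<open>petal_of\<close> is constant
  along walks; vertices \<open>1\<close> and \<open>4\<close> lie in petals \<open>0\<close> and
  \<open>1\<close>.\<close>

lemma (in petal_family) not_connected_del_root: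
  assumes "m \<ge> 2" "1 \<in> S 0" "1 \<in> S 1"
  shows "\<not> Digraph_Component.connected (pre_digraph.del_vert (with_proj (bouquet m S)) 0)"
proof
  let ?H = "with_proj (mk_symmetric (pre_digraph.del_vert (with_proj (bouquet m S)) 0))"
  assume "Digraph_Component.connected (pre_digraph.del_vert (with_proj (bouquet m S)) 0)"
  then have "strongly_connected ?H" by (simp add: Digraph_Component.connected_def)
  moreover have "1 \<in> verts ?H" "4 \<in> verts ?H"
    using assms in_V_iff[of 1 0] in_V_iff[of 1 1] by (simp_all add: mk_symmetric_def del_vert_simps)
  ultimately have "1 \<rightarrow>\<^sup>*\<^bsub>?H\<^esub> 4" by (auto simp: strongly_connected_def)
  then have "(1, 4) \<in> rtrancl_on (verts ?H) (arcs_ends ?H)" by (simp add: reachable_def)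
  then have "petal_of 1 = petal_of 4"
  proof induction
    case (step u v)
    have "(u, v) \<in> arcs_ends ?H \<Longrightarrow> petal_of u = petal_of v"
      by (auto simp: mk_symmetric_def del_vert_simps parcs_bouquet_iff)
    then show ?case using step by simp
  qed simp
  then show False by (simp add: petal_of_def)
qed

section \<open>The family\<close>

text \<open>Balance requires \<open>Q = 3 / 4 * (n - 1)\<close>. A diamond meets its share exactly,
  a triangle falls short by \<open>1 / 6\<close> and a pendant edge exceeds by \<open>1 / 4\<close>;
  hence \<open>3 t\<close> triangles against \<open>2 t\<close> edges. With \<open>d\<close>
  diamonds, half of the vertices are good if \<open>4 d = 1 + 3 d + 8 t\<close>, that is
  \<open>d = 8 t + 1\<close>.\<close>

definition half_good_petals :: "nat \<Rightarrow> nat \<Rightarrow> nat set" where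
  "half_good_petals t i =
    (if i < 8 * t + 1 then {1, 2, 3} else if i < 11 * t + 1 then {1, 2} else {1})"

definition half_good_graph :: "nat \<Rightarrow> nat pair_pre_digraph" where
  "half_good_graph t = bouquet (13 * t + 1) (half_good_petals t)"

interpretation half_good: petal_family "13 * t + 1" "half_good_petals t" for t
  by unfold_locales (auto simp: half_good_petals_def petals_def)

lemma sum_half_good_petals:
  "(\<Sum>i<13 * t + 1. f (half_good_petals t i)) =
    of_nat (8 * t + 1) * f {1, 2, 3} + of_nat (3 * t) * f {1, 2} + of_nat (2 * t) * f {1}"
  for f :: "nat set \<Rightarrow> 'a :: comm_semiring_1"
proof -
  have "(\<Sum>i<13 * t + 1. f (half_good_petals t i)) =
    (\<Sum>i=0..<8 * t + 1. f (half_good_petals t i)) + (\<Sum>i=8 * t + 1..<11 * t + 1. f (half_good_petals t i)) +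
    (\<Sum>i=11 * t + 1..<13 * t + 1. f (half_good_petals t i))"
    by (simp add: sum.atLeastLessThan_concat lessThan_atLeast0 del: sum.op_ivl_Suc)
  also have "\<dots> = (\<Sum>i=0..<8 * t + 1. f {1, 2, 3}) + (\<Sum>i=8 * t + 1..<11 * t + 1. f {1, 2}) +
    (\<Sum>i=11 * t + 1..<13 * t + 1. f {1})"
    by (intro arg_cong2[where f = "(+)"] sum.cong) (auto simp: half_good_petals_def)
  also have "\<dots> = of_nat (8 * t + 1) * f {1, 2, 3} + of_nat (3 * t) * f {1, 2} + of_nat (2 * t) * f {1}"
    by (simp only: sum_constant card_atLeastLessThan) simp
  finally show ?thesis .
qed

text \<open>Besides the three petals of the family, the list covers what single deletions leave of
  them.\<close>

lemma petal_sum_values: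
  "petal_sum {1, 2, 3} = 9 / 4" "petal_sum {1, 2} = 4 / 3" "petal_sum {1, 3} = 3"
  "petal_sum {2, 3} = 3" "petal_sum {1} = 1" "petal_sum {2} = 1" "petal_sum {} = 0"
  and petal_excess_values:
  "petal_excess {1, 2, 3} = - 5" "petal_excess {1, 2} = - 2" "petal_excess {1, 3} = - 5"
  "petal_excess {2, 3} = - 5" "petal_excess {1} = - 1" "petal_excess {2} = - 1" "petal_excess {} = 0"
proof -
  note [simp] = petal_sum_def petal_excess_def petal_resistance_def doubleton_eq_iff
    petal_neqs[unfolded One_nat_def]
  show "petal_sum {1, 2, 3} = 9 / 4" "petal_sum {1, 2} = 4 / 3" "petal_sum {1, 3} = 3"
    "petal_sum {2, 3} = 3" "petal_sum {1} = 1" "petal_sum {2} = 1" "petal_sum {} = 0"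
    "petal_excess {1, 2, 3} = - 5" "petal_excess {1, 2} = - 2" "petal_excess {1, 3} = - 5"
    "petal_excess {2, 3} = - 5" "petal_excess {1} = - 1" "petal_excess {2} = - 1" "petal_excess {} = 0"
    by simp_all
qed

lemma card_half_good_graph: "card (pverts (half_good_graph t)) = 32 * t + 4"
  using half_good.card_V[of t] sum_half_good_petals[of card t] by (simp add: half_good_graph_def)

lemma petal_sum_half_good: "(\<Sum>i<13 * t + 1. petal_sum (half_good_petals t i)) = 24 * real t + 9 / 4"
  unfolding sum_half_good_petals petal_sum_values by (simp add: field_simps)

lemma good_vertices_half_good_graph:
  assumes "t > 0"
  shows "good_vertices (with_proj (half_good_graph t)) =
    (\<lambda>(i, x). 3 * i + x) ` ({..<8 * t + 1} \<times> {1, 2})"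
proof -
  let ?S = "half_good_petals t" and ?m = "13 * t + 1" and ?G = "with_proj (half_good_graph t)"
  let ?good = "\<lambda>v. Digraph_Component.connected (pre_digraph.del_vert ?G v) \<and>
    kirchhoff_index ?G = kirchhoff_index (pre_digraph.del_vert ?G v)"
  have n: "real (card (pverts (bouquet ?m ?S))) = 32 * real t + 4"
    using card_half_good_graph[of t] by (simp add: half_good_graph_def)
  \<comment> \<open>Since \<open>t > 0\<close> there are at least two petals, and the root is a cut
    vertex.\<close>
  have root: "\<not> ?good 0"
    using half_good.not_connected_del_root[of t] assms by (simp add: half_good_graph_def half_good_petals_def)
  have petal: "?good (3 * i + x) \<longleftrightarrow> i < 8 * t + 1 \<and> x \<noteq> 3" if ix: "i < ?m" "x \<in> ?S i" for i x
  proof -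
    let ?balanced = "\<lambda>T x. 24 * real t + 9 / 4 =
      (32 * real t + 4 - 1) * (petal_sum (T - {x}) - petal_sum T) + petal_excess (T - {x}) - petal_excess T"
    have diff: "{1, 2, 3} - {1} = {2, 3 :: nat}" "{1, 2, 3} - {2} = {1, 3 :: nat}"
      "{1, 2, 3} - {3} = {1, 2 :: nat}" "{1, 2} - {1} = {2 :: nat}" "{1, 2} - {2} = {1 :: nat}"
      "{1} - {1} = ({} :: nat set)" by auto
    note vals = diff petal_sum_values petal_excess_values
    \<comment> \<open>Deleting slot \<open>1\<close> or \<open>2\<close> gives
      \<open>3 / 4 * (32 t + 3) = 24 t + 9 / 4\<close>, an equality. For slot \<open>3\<close>, and
      for triangles and edges below, the right side of \<open>?balanced\<close> is at most
      \<open>1 / 4\<close>.\<close>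
    have full: "{1, 2, 3} - {x} \<in> petals \<and> (?balanced {1, 2, 3} x \<longleftrightarrow> x \<noteq> 3)" if "x \<in> {1, 2, 3}"
    proof -
      from that consider "x = 1" | "x = 2" | "x = 3" by blast
      then show ?thesis
      proof cases
        case 1
        show ?thesis unfolding 1 vals by (simp add: petals_def field_simps)
      next
        case 2
        show ?thesis unfolding 2 vals by (simp add: petals_def field_simps)
      next
        case 3
        show ?thesis unfolding 3 vals by (simp add: petals_def field_simps)
      qed
    qed
    have triangle: "{1, 2} - {x} \<in> petals \<and> \<not> ?balanced {1, 2} x" if "x \<in> {1, 2}"
    proof -
      from that consider "x = 1" | "x = 2" by blast
      then show ?thesis
      proof cases
        case 1
        show ?thesis unfolding 1 vals by (simp add: petals_def field_simps)
      next
        case 2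
        show ?thesis unfolding 2 vals by (simp add: petals_def field_simps)
      qed
    qed
    have edge: "{1} - {x} \<in> petals \<and> \<not> ?balanced {1} x" if "x \<in> {1}"
    proof -
      from that have x: "x = 1" by blast
      show ?thesis unfolding x vals by (simp add: petals_def field_simps)
    qed
    consider "i < 8 * t + 1" "?S i = {1, 2, 3}" | "\<not> i < 8 * t + 1" "?S i = {1, 2}"
      | "\<not> i < 8 * t + 1" "?S i = {1}"
      by (cases "i < 8 * t + 1"; cases "i < 11 * t + 1"; simp add: half_good_petals_def)
    then have key: "?S i - {x} \<in> petals \<and> (?balanced (?S i) x \<longleftrightarrow> i < 8 * t + 1 \<and> x \<noteq> 3)"
      using ix(2) by cases (metis full, metis triangle, metis edge)
    then have T: "?S i - {x} \<in> petals" by blast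
    \<comment> \<open>The shrunken petal is admissible again, which makes the graph after deletion
      connected.\<close>
    interpret D: petal_family ?m "?S(i := ?S i - {x})"
      by unfold_locales (use half_good.S[of _ t] T in auto)
    have "Digraph_Component.connected (pre_digraph.del_vert ?G (3 * i + x))"
      using D.connected_bouquet half_good.del_vert_bouquet[OF ix] by (simp add: half_good_graph_def)
    then show ?thesis
      using half_good.kirchhoff_index_del_vert_iff[OF ix T] key
      unfolding half_good_graph_def n petal_sum_half_good by blast
  qed
  show ?thesis
  proof (rule set_eqI)
    fix v
    show "v \<in> good_vertices ?G \<longleftrightarrow> v \<in> (\<lambda>(i, x). 3 * i + x) ` ({..<8 * t + 1} \<times> {1, 2})"
    proof
      assume "v \<in> good_vertices ?G"
      then have v: "v \<in> pverts (bouquet ?m ?S)" "?good v"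
        by (simp_all add: good_vertices_def half_good_graph_def)
      from v(1) obtain i x where ix: "i < ?m" "x \<in> ?S i" "v = 3 * i + x"
        using root v(2) by (cases rule: half_good.V_cases) auto
      then have "i < 8 * t + 1" "x \<noteq> 3" using petal v(2) by auto
      moreover have "x \<in> {1, 2, 3}" using half_good.S_slot[OF ix(1,2)] .
      ultimately show "v \<in> (\<lambda>(i, x). 3 * i + x) ` ({..<8 * t + 1} \<times> {1, 2})"
        using ix(3) by (intro image_eqI[of _ _ "(i, x)"]) auto
    next
      assume "v \<in> (\<lambda>(i, x). 3 * i + x) ` ({..<8 * t + 1} \<times> {1, 2})"
      then obtain i x where v: "v = 3 * i + x" "i < 8 * t + 1" "x \<in> {1, 2}" by auto
      then have ix: "i < ?m" "x \<in> ?S i" "x \<noteq> 3" by (auto simp: half_good_petals_def)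
      then have "v \<in> pverts (bouquet ?m ?S)" using v(1) by (auto simp: pverts_bouquet)
      then show "v \<in> good_vertices ?G"
        using petal[OF ix(1,2)] v ix(3) by (simp add: good_vertices_def half_good_graph_def)
    qed
  qed
qed

lemma card_good_vertices_half_good_graph:
  assumes "t > 0"
  shows "card (good_vertices (with_proj (half_good_graph t))) = 16 * t + 2"
proof -
  have "inj_on (\<lambda>(i, x). 3 * i + x) ({..<8 * t + 1} \<times> {1, 2 :: nat})"
  proof (rule inj_onI, clarify)
    fix i x j y :: nat
    assume "x \<in> {1, 2}" "y \<in> {1, 2}" "3 * i + x = 3 * j + y"
    then show "i = j \<and> x = y" using petal_slot_inj[of x y i j] by auto
  qed
  then show ?thesis
    by (simp add: good_vertices_half_good_graph[OF assms] card_image card_cartesian_product)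
qed

lemma digraph_iso_card_verts:
  assumes "digraph_iso G H"
  shows "card (verts G) = card (verts H)"
  using assms pre_digraph.digraph_isomorphism_inj_on_verts
  by (fastforce simp: digraph_iso_def card_image)

theorem theorem11:
  shows "\<exists>\<G> :: nat pair_pre_digraph set.
    infinite \<G> \<and>
    (\<forall>G\<in>\<G>. pair_graph G \<and> Digraph_Component.connected (with_proj G) \<and>
       real (card (good_vertices (with_proj G))) = 1 / 2 * real (card (pverts G))) \<and>
    pairwise (\<lambda>G H. \<not> digraph_iso (with_proj G) (with_proj H)) \<G>"
proof (intro exI conjI)
  let ?\<G> = "half_good_graph ` {0<..}"
  have "inj half_good_graph"
    by (rule injI) (metis card_half_good_graph add_right_cancel mult_cancel1 zero_neq_numeral)
  then show "infinite ?\<G>"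
    using infinite_Ioi finite_imageD inj_on_subset by blast
  show "\<forall>G\<in>?\<G>. pair_graph G \<and> Digraph_Component.connected (with_proj G) \<and>
       real (card (good_vertices (with_proj G))) = 1 / 2 * real (card (pverts G))"
    using half_good.connected_bouquet half_good.pair_graph_axioms
    by (auto simp: card_half_good_graph card_good_vertices_half_good_graph)
      (auto simp: half_good_graph_def)
  \<comment> \<open>The orders \<open>32 t + 4\<close> already distinguish the graphs.\<close>
  show "pairwise (\<lambda>G H. \<not> digraph_iso (with_proj G) (with_proj H)) ?\<G>"
    by (auto simp: pairwise_def card_half_good_graph dest!: digraph_iso_card_verts)
qed

end
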